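(* Let $k$ and $n$ be positive integers, and let $$F_k(n):=\sigma_k^{(-1)}(n)+\mu(n)+J_k(n)+3.$$ Then $$F_k(n)=0\quad\Longleftrightarrow\quad\begin{cases} n\text{ is prime or }n=18, & \text{if }k=1,\\ n\text{ is prime}, & \text{if }k\geq 2.\end{cases}$$
   Context: For arithmetic functions $f,g:\{1,2,3,\ldots\}\to\mathbb{Z}$, the Dirichlet convolution is $(f*g)(n)=\sum_{d\mid n}f(d)g(n/d)$, with identity $\varepsilon$ given by $\varepsilon(1)=1$ and $\varepsilon(n)=0$ for $n>1$. If $f(1)\neq 0$, then $f^{(-1)}$ denotes the Dirichlet inverse of $f$ (not the pointwise reciprocal), i.e. the unique arithmetic function with $f*f^{(-1)}=\varepsilon$. For an integer $k\ge 1$, $\sigma_k(n)=\sum_{d\mid n}d^k$, and $\sigma_k^{(-1)}$ is its Dirichlet inverse. $\mu$ is the Möbius function. The $k$th Jordan totient function is $J_k(n)=\sum_{d\mid n}\mu(n/d)d^k=n^k\prod_{p\mid n}(1-p^{-k})$, the product being over primes $p$ dividing $n$. *)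

theory Defs
  imports "HOL-Computational_Algebra.Computational_Algebra"
begin

(* Arithmetic functions are rendered as functions nat => int; the value at 0 is irrelevant. *)

definition dirichlet_conv :: "(nat \<Rightarrow> int) \<Rightarrow> (nat \<Rightarrow> int) \<Rightarrow> nat \<Rightarrow> int" where
  "dirichlet_conv f g n = (\<Sum>d | d dvd n. f d * g (n div d))"

definition dirichlet_id :: "nat \<Rightarrow> int" where
  "dirichlet_id n = (if n = 1 then 1 else 0)"

(* Since 0 is not in the domain of an arithmetic function, the clause g 0 = 0 only normalises
   the junk value so that the inverse is unique as a function on nat. *)
definition is_dirichlet_inverse :: "(nat \<Rightarrow> int) \<Rightarrow> (nat \<Rightarrow> int) \<Rightarrow> bool" where
  "is_dirichlet_inverse f g \<longleftrightarrow> g 0 = 0 \<and> (\<forall>n\<ge>1. dirichlet_conv f g n = dirichlet_id n)"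

(* Meaningful only if f 1 is a unit of the integers; see dirichlet_inverse_ex1 below. *)
definition dirichlet_inverse :: "(nat \<Rightarrow> int) \<Rightarrow> nat \<Rightarrow> int" where
  "dirichlet_inverse f = (THE g. is_dirichlet_inverse f g)"

definition divisor_sigma :: "nat \<Rightarrow> nat \<Rightarrow> int" where
  "divisor_sigma k n = (\<Sum>d | d dvd n. int d ^ k)"

definition moebius_mu :: "nat \<Rightarrow> int" where
  "moebius_mu n = (if squarefree n then (- 1) ^ card (prime_factors n) else 0)"

definition jordan_totient :: "nat \<Rightarrow> nat \<Rightarrow> int" where
  "jordan_totient k n = (\<Sum>d | d dvd n. moebius_mu (n div d) * int d ^ k)"

definition Fk :: "nat \<Rightarrow> nat \<Rightarrow> int" where
  "Fk k n = dirichlet_inverse (divisor_sigma k) n + moebius_mu n + jordan_totient k n + 3"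

lemma dirichlet_conv_split:
  assumes "n \<ge> 1"
  shows "dirichlet_conv f g n = f 1 * g n + (\<Sum>d | d dvd n \<and> d \<noteq> 1. f d * g (n div d))"
proof -
  have "{d. d dvd n} = insert 1 {d. d dvd n \<and> d \<noteq> 1}" by auto
  moreover have "finite {d. d dvd n \<and> d \<noteq> 1}" using assms by auto
  ultimately show ?thesis by (simp add: dirichlet_conv_def)
qed

function dirichlet_inverse_rec :: "(nat \<Rightarrow> int) \<Rightarrow> nat \<Rightarrow> int" where
  "dirichlet_inverse_rec f n = (if n = 0 then 0 else
     f 1 * (dirichlet_id n - (\<Sum>d | d dvd n \<and> d \<noteq> 1. f d * dirichlet_inverse_rec f (n div d))))"
  by auto
termination
  by (relation "measure snd") (auto intro!: div_less_dividend dest: Nat.gr0I)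

declare dirichlet_inverse_rec.simps [simp del]

lemma dirichlet_inverse_ex1:
  assumes "is_unit (f 1)"
  shows "\<exists>!g. is_dirichlet_inverse f g"
proof -
  have sq: "f 1 * f 1 = 1" using assms by (auto simp: zdvd1_eq abs_if split: if_splits)
  show ?thesis
  proof (rule ex1I)
    have "dirichlet_conv f (dirichlet_inverse_rec f) n = dirichlet_id n" if "n \<ge> 1" for n
      using that sq
      by (subst dirichlet_conv_split, simp, subst dirichlet_inverse_rec.simps)
         (simp flip: mult.assoc)
    then show "is_dirichlet_inverse f (dirichlet_inverse_rec f)"
      by (simp add: is_dirichlet_inverse_def dirichlet_inverse_rec.simps)
  next
    fix g assume g: "is_dirichlet_inverse f g"
    have "g n = dirichlet_inverse_rec f n" for n
    proof (induction n rule: less_induct)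
      case (less n)
      show ?case
      proof (cases "n = 0")
        case True
        with g show ?thesis by (simp add: is_dirichlet_inverse_def dirichlet_inverse_rec.simps)
      next
        case False
        let ?S = "\<lambda>g. (\<Sum>d | d dvd n \<and> d \<noteq> 1. f d * g (n div d))"
        have "f 1 * g n + ?S g = dirichlet_id n"
          using g False dirichlet_conv_split[of n f g] by (simp add: is_dirichlet_inverse_def)
        then have "f 1 * (f 1 * g n) = f 1 * (dirichlet_id n - ?S g)"
          by (metis add_diff_cancel_right')
        then have 1: "g n = f 1 * (dirichlet_id n - ?S g)"
          by (metis sq mult.assoc mult_1)
        have 2: "?S g = ?S (dirichlet_inverse_rec f)"
        proof (rule sum.cong)
          fix d assume d: "d \<in> {d. d dvd n \<and> d \<noteq> 1}"
          then have "d > 1" using False by (cases d) auto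
          then have "n div d < n" using False by simp
          then show "f d * g (n div d) = f d * dirichlet_inverse_rec f (n div d)"
            using less by simp
        qed simp
        show ?thesis
          using False 1 unfolding 2 by (simp add: dirichlet_inverse_rec.simps[of f n])
      qed
    qed
    then show "g = dirichlet_inverse_rec f" by blast
  qed
qed

lemma dirichlet_inverse_divisor_sigma:
  "is_dirichlet_inverse (divisor_sigma k) (dirichlet_inverse (divisor_sigma k))"
  unfolding dirichlet_inverse_def
  by (rule theI'[OF dirichlet_inverse_ex1]) (simp add: divisor_sigma_def)

end

theory Submission
  imports Defs
begin

text \<open>
  The inverse of \<open>\<sigma>\<^sub>k\<close> and \<open>J\<^sub>k\<close> are multiplicative, so both are determined by their values at
  prime powers. For a prime \<open>p\<close> and \<open>q = p\<^sup>k\<close>, the first one takes the values \<open>-(1 + q)\<close> at \<open>p\<close>,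
  \<open>q\<close> at \<open>p\<^sup>2\<close> and 0 at all higher powers of \<open>p\<close> (\<open>sigma_inverse_prime_power\<close>), while
  \<open>J\<^sub>k(p\<^sup>e) = q\<^sup>e - q\<^bsup>e-1\<^esup>\<close> (\<open>jordan_totient_prime_power\<close>). In particular
  \<open>F\<^sub>k(p) = -(1 + q) - 1 + (q - 1) + 3 = 0\<close>. It remains to examine the \<open>n\<close> that are not prime.

  If \<open>n\<close> is squarefree, the question is one of size (\<open>Fk_squarefree_nonzero\<close>). For an even number
  of prime factors no summand is negative. For an odd number the two large terms nearly cancel:
  \<open>F\<^sub>k(n) = \<Prod>(p\<^sup>k - 1) - \<Prod>(p\<^sup>k + 1) + 2\<close>, which is 0 for one prime and negative for at least two.

  If \<open>n\<close> has a square factor, the question is one of divisibility (\<open>zero_with_square_factor\<close>). Each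
  prime \<open>p\<close> with \<open>p\<^sup>2\<close> dividing \<open>n\<close> makes \<open>p\<^sup>k\<close> divide every summand but the constant, so a zero
  forces \<open>p\<^sup>k\<close> to divide 3, that is, \<open>p = 3\<close> and \<open>k = 1\<close>. Since \<open>F\<^sub>1(n) > 0\<close> when 27 divides \<open>n\<close>, a zero
  has the form \<open>n = 9 * m\<close> with \<open>m\<close> squarefree and prime to 3. After division by 3 the equation
  becomes \<open>\<sigma>\<^sub>1\<^bsup>(-1)\<^esup>(m) + 2 J\<^sub>1(m) + 1 = 0\<close>. An odd prime factor of \<open>m\<close> would make the left-hand side
  odd; hence \<open>m\<close> is 1 or 2, and of these only 2 is a solution.
\<close>

section \<open>Multiplicative functions and Dirichlet convolution\<close>

definition multiplicative :: "(nat \<Rightarrow> int) \<Rightarrow> bool" where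
  "multiplicative f \<longleftrightarrow> f 1 = 1 \<and>
     (\<forall>m n. m > 0 \<longrightarrow> n > 0 \<longrightarrow> coprime m n \<longrightarrow> f (m * n) = f m * f n)"

lemma multiplicativeD:
  assumes "multiplicative f" "m > 0" "n > 0" "coprime m n"
  shows "f (m * n) = f m * f n"
  using assms by (simp add: multiplicative_def)

lemma multiplicative_1: "multiplicative f \<Longrightarrow> f (Suc 0) = 1"
  by (simp add: multiplicative_def)

lemma multiplicative_prod_prime_powers:
  assumes "multiplicative f" "finite A" "\<And>p. p \<in> A \<Longrightarrow> prime p"
  shows "f (\<Prod>p\<in>A. p ^ e p) = (\<Prod>p\<in>A. f (p ^ e p))"
  using assms(2,3)
proof (induction A rule: finite_induct)
  case empty
  then show ?case using assms(1) by (simp add: multiplicative_1)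
next
  case (insert q A)
  have "coprime (q ^ e q) (\<Prod>p\<in>A. p ^ e p)"
  proof (rule prod_coprime_right)
    fix p assume "p \<in> A"
    then have "prime p" "prime q" "p \<noteq> q" using insert by auto
    then show "coprime (q ^ e q) (p ^ e p)"
      by (simp add: primes_coprime)
  qed
  moreover have "q ^ e q > 0" "(\<Prod>p\<in>A. p ^ e p) > 0"
    using insert.prems by (auto intro!: prod_pos simp: prime_gt_0_nat)
  ultimately show ?case
    using insert multiplicativeD[OF assms(1)] by simp
qed

lemma multiplicative_eq_prod_prime_powers:
  assumes "multiplicative f" "n > 0"
  shows "f n = (\<Prod>p\<in>prime_factors n. f (p ^ multiplicity p n))"
proof -
  have "f n = f (\<Prod>p\<in>prime_factors n. p ^ multiplicity p n)"
    using assms(2) prod_prime_factors[of n] by simp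
  also have "\<dots> = (\<Prod>p\<in>prime_factors n. f (p ^ multiplicity p n))"
    by (rule multiplicative_prod_prime_powers[OF assms(1)]) auto
  finally show ?thesis .
qed

lemma squarefree_multiplicity_prime_factor:
  fixes n :: nat
  assumes "squarefree n" "p \<in> prime_factors n"
  shows "multiplicity p n = 1"
proof -
  have "n \<noteq> 0" using assms(1) by (metis not_squarefree_0)
  then show ?thesis using assms squarefree_factorial_semiring' by blast
qed

lemma multiplicative_squarefree:
  assumes "multiplicative f" "squarefree n" "n > 0"
  shows "f n = (\<Prod>p\<in>prime_factors n. f p)"
proof -
  have "multiplicity p n = 1" if "p \<in> prime_factors n" for p
    using squarefree_multiplicity_prime_factor that assms by blast
  then show ?thesis
    using multiplicative_eq_prod_prime_powers[OF assms(1,3)] by simp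
qed

text \<open>Every divisor of a product of coprime numbers factors uniquely into a divisor of each factor;
  the first one is recovered from the product as its greatest common divisor with the first number.\<close>

lemma sum_divisors_coprime_mult:
  fixes h :: "nat \<Rightarrow> int"
  assumes "coprime m n"
  shows "(\<Sum>d | d dvd m * n. h d) = (\<Sum>(a, b)\<in>{a. a dvd m} \<times> {b. b dvd n}. h (a * b))"
proof -
  let ?D = "{a. a dvd m} \<times> {b. b dvd n}" and ?f = "\<lambda>(a, b). a * b"
  have gcd1: "gcd (a * b) m = a" and gcd2: "gcd (a * b) n = b" if "a dvd m" "b dvd n" for a b
  proof -
    have "coprime b m" "coprime a n"
      using assms that by (meson coprime_commute coprime_divisors dvd_refl)+
    then have "gcd (a * b) m = gcd a m" "gcd (a * b) n = gcd b n"
      by (simp_all add: gcd_mult_left_left_cancel gcd_mult_left_right_cancel coprime_commute)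
    with that show "gcd (a * b) m = a" "gcd (a * b) n = b"
      by simp_all
  qed
  have "inj_on ?f ?D"
    by (rule inj_onI) (clarsimp, metis gcd1 gcd2)
  moreover have "?f ` ?D = {d. d dvd m * n}"
  proof (intro equalityI subsetI)
    fix d assume "d \<in> {d. d dvd m * n}"
    then show "d \<in> ?f ` ?D" using division_decomp[of d m n] by auto
  qed (auto intro: mult_dvd_mono)
  ultimately have "bij_betw ?f ?D {d. d dvd m * n}"
    by (simp add: bij_betw_def)
  from sum.reindex_bij_betw[OF this, of h] show ?thesis
    by (simp add: case_prod_unfold)
qed

lemma dirichlet_conv_coprime_mult:
  assumes "coprime m n"
  shows "dirichlet_conv f g (m * n) =
    (\<Sum>(a, b)\<in>{a. a dvd m} \<times> {b. b dvd n}. f (a * b) * g ((m div a) * (n div b)))"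
  unfolding dirichlet_conv_def sum_divisors_coprime_mult[OF assms]
  by (intro sum.cong) (auto simp: div_mult_div_if_dvd)

lemma dirichlet_conv_mult_product:
  "dirichlet_conv f g m * dirichlet_conv f g n =
    (\<Sum>(a, b)\<in>{a. a dvd m} \<times> {b. b dvd n}. (f a * f b) * (g (m div a) * g (n div b)))"
  unfolding dirichlet_conv_def sum_product sum.cartesian_product
  by (intro sum.cong) (auto simp: algebra_simps)

lemma pos_divisor_and_quotient:
  fixes a m :: nat
  assumes "m > 0" "a dvd m"
  shows "a > 0" "m div a > 0"
  using assms by (auto elim!: dvdE intro: Nat.gr0I)

lemma coprime_divisors_and_quotients:
  fixes m n :: nat
  assumes "coprime m n" "a dvd m" "b dvd n"
  shows "coprime a b" "coprime (m div a) (n div b)"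
proof -
  show "coprime a b" using assms coprime_divisors by blast
  have "m div a dvd m" "n div b dvd n" using assms(2,3) by (auto elim!: dvdE)
  then show "coprime (m div a) (n div b)" using assms(1) coprime_divisors by blast
qed

lemma multiplicative_dirichlet_conv:
  assumes f: "multiplicative f" and g: "multiplicative g"
  shows "multiplicative (dirichlet_conv f g)"
  unfolding multiplicative_def
proof (intro conjI allI impI)
  show "dirichlet_conv f g 1 = 1"
    using f g by (simp add: dirichlet_conv_def multiplicative_1)
next
  fix m n :: nat assume mn: "m > 0" "n > 0" "coprime m n"
  show "dirichlet_conv f g (m * n) = dirichlet_conv f g m * dirichlet_conv f g n"
    unfolding dirichlet_conv_coprime_mult[OF mn(3)] dirichlet_conv_mult_product
  proof (intro sum.cong refl, clarify)
    fix a b assume "a dvd m" "b dvd n"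
    then show "f (a * b) * g (m div a * (n div b)) = f a * f b * (g (m div a) * g (n div b))"
      using mn coprime_divisors_and_quotients[OF mn(3)] pos_divisor_and_quotient
      by (simp add: multiplicativeD[OF f] multiplicativeD[OF g])
  qed
qed

text \<open>Strong induction on \<open>m * n\<close>: in the expansions of \<open>(f * g)(m * n)\<close> and of
  \<open>(f * g)(m) (f * g)(n)\<close> all terms except the one for \<open>a = b = 1\<close> agree by induction, and the two
  expansions have the same value since \<open>\<epsilon>\<close> is multiplicative. So the remaining terms,
  \<open>g (m * n)\<close> and \<open>g m * g n\<close>, agree as well.\<close>

lemma multiplicative_inverse:
  assumes f: "multiplicative f" and inv: "is_dirichlet_inverse f g"
  shows "multiplicative g"
proof -
  have conv: "dirichlet_conv f g n = dirichlet_id n" if "n > 0" for n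
    using inv that by (simp add: is_dirichlet_inverse_def)
  have g1: "g 1 = 1"
    using conv[of 1] multiplicative_1[OF f] by (simp add: dirichlet_conv_def dirichlet_id_def)
  have "m > 0 \<longrightarrow> n > 0 \<longrightarrow> coprime m n \<longrightarrow> g (m * n) = g m * g n" for m n
  proof (induction "m * n" arbitrary: m n rule: less_induct)
    case less
    show ?case
    proof (intro impI)
      assume mn: "m > 0" "n > 0" "coprime m n"
      let ?D = "{a. a dvd m} \<times> {b. b dvd n}"
      let ?s = "\<lambda>(a, b). f (a * b) * g ((m div a) * (n div b))"
      let ?t = "\<lambda>(a, b). (f a * f b) * (g (m div a) * g (n div b))"
      have fin: "finite ?D" and one: "(1, 1) \<in> ?D" using mn by auto
      have "sum ?s ?D = dirichlet_id (m * n)"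
        using conv[of "m * n"] mn dirichlet_conv_coprime_mult[OF mn(3), of f g] by simp
      also have "\<dots> = dirichlet_id m * dirichlet_id n"
        by (simp add: dirichlet_id_def)
      also have "\<dots> = sum ?t ?D"
        using conv mn dirichlet_conv_mult_product[of f g m n] by simp
      finally have eq: "sum ?s ?D = sum ?t ?D" .
      have "sum ?s (?D - {(1, 1)}) = sum ?t (?D - {(1, 1)})"
      proof (intro sum.cong refl)
        fix x assume "x \<in> ?D - {(1, 1)}"
        then obtain a b where x: "x = (a, b)" and ab: "a dvd m" "b dvd n" "\<not> (a = 1 \<and> b = 1)"
          by (cases x) auto
        note pos = pos_divisor_and_quotient[OF mn(1) ab(1)] pos_divisor_and_quotient[OF mn(2) ab(2)]
        note cop = coprime_divisors_and_quotients[OF mn(3) ab(1,2)]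
        have "(m div a) * (n div b) = (m * n) div (a * b)"
          using ab by (simp add: div_mult_div_if_dvd)
        also have "a * b \<noteq> 0" "a * b \<noteq> 1" using ab(3) pos by auto
        then have "a * b > 1" by linarith
        then have "(m * n) div (a * b) < m * n" using mn by simp
        finally have "g ((m div a) * (n div b)) = g (m div a) * g (n div b)"
          using less[of "m div a" "n div b"] pos cop by simp
        then show "?s x = ?t x"
          using multiplicativeD[OF f pos(1,3) cop(1)] by (simp add: x)
      qed
      then have "?s (1, 1) = ?t (1, 1)"
        using eq sum.remove[OF fin one, of ?s] sum.remove[OF fin one, of ?t] by linarith
      then show "g (m * n) = g m * g n"
        using multiplicative_1[OF f] by simp
    qed
  qed
  with g1 show ?thesis by (simp add: multiplicative_def)
qed

lemma multiplicative_power: "multiplicative (\<lambda>n. int n ^ k)"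
  by (simp add: multiplicative_def power_mult_distrib)

lemma multiplicative_moebius_mu: "multiplicative moebius_mu"
  unfolding multiplicative_def
proof (intro conjI allI impI)
  fix m n :: nat assume mn: "m > 0" "n > 0" "coprime m n"
  have "prime_factors m \<inter> prime_factors n = {}"
    using mn(3) by (auto simp: in_prime_factors_iff dest: coprime_common_divisor_nat not_prime_unit)
  then have "card (prime_factors (m * n)) = card (prime_factors m) + card (prime_factors n)"
    using mn by (simp add: prime_factors_product card_Un_disjoint)
  moreover have "squarefree (m * n) \<longleftrightarrow> squarefree m \<and> squarefree n"
    using squarefree_mult_coprime[OF mn(3)] squarefree_multD by blast
  ultimately show "moebius_mu (m * n) = moebius_mu m * moebius_mu n"
    by (simp add: moebius_mu_def power_add)
qed (simp add: moebius_mu_def)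

lemma divisor_sigma_eq_conv: "divisor_sigma k = dirichlet_conv (\<lambda>d. int d ^ k) (\<lambda>_. 1)"
  by (simp add: fun_eq_iff divisor_sigma_def dirichlet_conv_def)

lemma jordan_totient_eq_conv: "jordan_totient k = dirichlet_conv (\<lambda>d. int d ^ k) moebius_mu"
  by (simp add: fun_eq_iff jordan_totient_def dirichlet_conv_def mult.commute)

lemma multiplicative_divisor_sigma: "multiplicative (divisor_sigma k)"
  unfolding divisor_sigma_eq_conv
  by (intro multiplicative_dirichlet_conv multiplicative_power) (simp add: multiplicative_def)

lemma multiplicative_jordan_totient: "multiplicative (jordan_totient k)"
  unfolding jordan_totient_eq_conv
  by (intro multiplicative_dirichlet_conv multiplicative_power multiplicative_moebius_mu)

abbreviation sigma_inverse :: "nat \<Rightarrow> nat \<Rightarrow> int" where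
  "sigma_inverse k \<equiv> dirichlet_inverse (divisor_sigma k)"

lemma multiplicative_sigma_inverse: "multiplicative (sigma_inverse k)"
  by (rule multiplicative_inverse[OF multiplicative_divisor_sigma dirichlet_inverse_divisor_sigma])

section \<open>Values at prime powers\<close>

lemma dirichlet_conv_prime_power:
  assumes p: "prime p"
  shows "dirichlet_conv f g (p ^ e) = (\<Sum>i\<le>e. f (p ^ i) * g (p ^ (e - i)))"
proof -
  have p1: "p > 1" using p by (rule prime_gt_1_nat)
  have D: "{d. d dvd p ^ e} = (\<lambda>i. p ^ i) ` {..e}"
    using divides_primepow_nat[OF p] by auto
  have "inj_on (\<lambda>i. p ^ i) {..e}"
    using p1 by (auto intro!: inj_onI dest: power_inject_exp[THEN iffD1, rotated])
  moreover have "p ^ e div p ^ i = p ^ (e - i)" if "i \<le> e" for i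
    using that p1 by (simp add: power_diff)
  ultimately show ?thesis
    unfolding dirichlet_conv_def D by (simp add: sum.reindex)
qed

lemma divisor_sigma_prime_power:
  assumes "prime p"
  shows "divisor_sigma k (p ^ e) = (\<Sum>i\<le>e. (int p ^ k) ^ i)"
  unfolding divisor_sigma_eq_conv dirichlet_conv_prime_power[OF assms]
  by (simp flip: power_mult add: mult.commute)

text \<open>With \<open>q = p\<^sup>k\<close>, the generating function of \<open>\<sigma>\<^sub>k(p\<^sup>e)\<close> over \<open>e\<close> is
  \<open>1 / ((1 - x) (1 - q x))\<close>. Hence the inverse has the generating function
  \<open>(1 - x) (1 - q x) = 1 - (1 + q) x + q x\<^sup>2\<close>, whose coefficients are the values below.\<close>

lemma sigma_inverse_prime_power:
  assumes p: "prime p"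
  shows "sigma_inverse k (p ^ e) =
    (if e = 0 then 1 else if e = 1 then - (1 + int p ^ k) else if e = 2 then int p ^ k else 0)"
proof -
  define q where "q = int p ^ k"
  define s where "s = (\<lambda>e. divisor_sigma k (p ^ e))"
  define g where "g = (\<lambda>e. sigma_inverse k (p ^ e))"
  define h where "h = (\<lambda>e::nat. if e = 0 then 1 else if e = 1 then - (1 + q) else if e = 2 then q else 0)"
  have s: "s e = (\<Sum>i\<le>e. q ^ i)" for e
    using divisor_sigma_prime_power[OF p] by (simp add: s_def q_def)
  have g: "(\<Sum>i\<le>e. g i * s (e - i)) = (if e = 0 then 1 else 0)" for e
  proof -
    have "p ^ e \<ge> 1" using prime_gt_0_nat[OF p] by simp
    then have "(\<Sum>i\<le>e. s i * g (e - i)) = dirichlet_id (p ^ e)"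
      using dirichlet_inverse_divisor_sigma[of k]
      unfolding s_def g_def is_dirichlet_inverse_def dirichlet_conv_prime_power[OF p, symmetric]
      by blast
    moreover have "(\<Sum>i\<le>e. s i * g (e - i)) = (\<Sum>i\<le>e. g i * s (e - i))"
      by (rule sum.reindex_bij_witness[of _ "\<lambda>i. e - i" "\<lambda>i. e - i"]) auto
    moreover have "p ^ e = 1 \<longleftrightarrow> e = 0"
      using prime_gt_1_nat[OF p] by simp
    ultimately show ?thesis by (simp add: dirichlet_id_def)
  qed
  have h: "(\<Sum>i\<le>e. h i * s (e - i)) = (if e = 0 then 1 else 0)" for e
  proof -
    consider "e = 0" | "e = 1" | m where "e = Suc (Suc m)"
      by (metis One_nat_def not0_implies_Suc)
    then show ?thesis
    proof cases
      case 3
      have "(\<Sum>i\<le>e. h i * s (e - i)) = (\<Sum>i\<in>{0,1,2}. h i * s (e - i))"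
        using 3 by (intro sum.mono_neutral_right) (auto simp: h_def)
      also have "\<dots> = s (Suc (Suc m)) - (1 + q) * s (Suc m) + q * s m"
        using 3 by (simp add: h_def numeral_2_eq_2 algebra_simps)
      \<comment> \<open>The geometric sums satisfy \<open>s (e + 1) - s e = q (s e - s (e - 1))\<close>.\<close>
      also have "\<dots> = 0" by (simp add: s algebra_simps)
      finally show ?thesis using 3 by simp
    qed (auto simp: h_def s)
  qed
  \<comment> \<open>Both sequences invert \<open>s\<close>, and \<open>s 0 = 1\<close> lets the convolution equations be solved recursively.\<close>
  have "g e = h e" for e
  proof (induction e rule: less_induct)
    case (less e)
    have "(\<Sum>i<e. g i * s (e - i)) = (\<Sum>i<e. h i * s (e - i))"
      using less by simp
    moreover have "s 0 = 1" by (simp add: s)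
    ultimately show ?case
      using g[of e] h[of e] by (simp add: lessThan_Suc_atMost[symmetric])
  qed
  then show ?thesis by (simp add: g_def h_def q_def)
qed

lemma moebius_mu_prime_power:
  assumes "prime p"
  shows "moebius_mu (p ^ e) = (if e = 0 then 1 else if e = 1 then -1 else 0)"
  using assms prime_gt_1_nat[OF assms]
  by (auto simp: moebius_mu_def squarefree_power_iff squarefree_prime prime_prime_factors)

lemma jordan_totient_prime_power:
  assumes p: "prime p" and "e > 0"
  shows "jordan_totient k (p ^ e) = (int p ^ k) ^ (e - 1) * (int p ^ k - 1)"
proof -
  obtain m where e: "e = Suc m" using assms(2) gr0_implies_Suc by blast
  have "jordan_totient k (p ^ e) = (\<Sum>i\<le>e. int (p ^ i) ^ k * moebius_mu (p ^ (e - i)))"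
    unfolding jordan_totient_eq_conv dirichlet_conv_prime_power[OF p] ..
  also have "\<dots> = (\<Sum>i\<in>{m, Suc m}. int (p ^ i) ^ k * moebius_mu (p ^ (e - i)))"
    by (intro sum.mono_neutral_right) (auto simp: e moebius_mu_prime_power[OF p])
  also have "\<dots> = int (p ^ Suc m) ^ k - int (p ^ m) ^ k"
    using moebius_mu_prime_power[OF p, of 1] moebius_mu_prime_power[OF p, of 0] by (simp add: e)
  also have "\<dots> = (int p ^ k) ^ m * (int p ^ k - 1)"
    by (simp add: algebra_simps flip: power_mult)
  finally show ?thesis by (simp add: e)
qed

lemma sigma_inverse_prime: "prime p \<Longrightarrow> sigma_inverse k p = - (1 + int p ^ k)"
  using sigma_inverse_prime_power[of p k 1] by simp

lemma jordan_totient_prime: "prime p \<Longrightarrow> jordan_totient k p = int p ^ k - 1"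
  using jordan_totient_prime_power[of p 1 k] by simp

lemma jordan_totient_nonneg:
  assumes "n > 0"
  shows "jordan_totient k n \<ge> 0"
  unfolding multiplicative_eq_prod_prime_powers[OF multiplicative_jordan_totient assms]
proof (rule prod_nonneg)
  fix p assume "p \<in> prime_factors n"
  then have p: "prime p" and e: "multiplicity p n > 0"
    using assms by (auto simp: prime_factors_multiplicity)
  show "jordan_totient k (p ^ multiplicity p n) \<ge> 0"
    using prime_gt_0_nat[OF p] by (simp add: jordan_totient_prime_power[OF p e])
qed

section \<open>Squarefree numbers\<close>

text \<open>For products \<open>P\<close> and \<open>M\<close> of the shifted factors over \<open>A\<close>, inserting a factor \<open>x\<close> changes the gap
  to \<open>(x + 1) P - (x - 1) M = x (P - M) + P + M\<close>. With \<open>x \<ge> 2\<close>, the gap thus grows strictly as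
  soon as \<open>P - M > 0\<close>, that is, from the second factor on.\<close>

lemma prod_shift_gap:
  fixes x :: "'a \<Rightarrow> int"
  assumes "finite A" "\<And>a. a \<in> A \<Longrightarrow> x a \<ge> 2"
  shows "(\<Prod>a\<in>A. x a - 1) \<ge> 1 \<and>
    (A \<noteq> {} \<longrightarrow> (\<Prod>a\<in>A. x a + 1) \<ge> (\<Prod>a\<in>A. x a - 1) + 2) \<and>
    (card A \<ge> 2 \<longrightarrow> (\<Prod>a\<in>A. x a + 1) > (\<Prod>a\<in>A. x a - 1) + 2)"
  using assms
proof (induction A rule: finite_induct)
  case (insert b A)
  define P where "P = (\<Prod>a\<in>A. x a + 1)"
  define M where "M = (\<Prod>a\<in>A. x a - 1)"
  have IH: "M \<ge> 1" "A \<noteq> {} \<Longrightarrow> P \<ge> M + 2" and b: "x b \<ge> 2"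
    using insert by (auto simp: P_def M_def)
  have "(x b - 1) * M \<ge> 1 * 1" using IH(1) b by (intro mult_mono) auto
  moreover have "(x b + 1) * P > (x b - 1) * M + 2" if "A \<noteq> {}"
  proof -
    have "x b * (P - M) \<ge> 2 * 2" using IH(2)[OF that] b by (intro mult_mono) auto
    then show ?thesis using IH(1) IH(2)[OF that] by (simp add: algebra_simps)
  qed
  moreover have "A = {} \<Longrightarrow> P = 1 \<and> M = 1" by (simp add: P_def M_def)
  ultimately show ?case
    using insert.hyps by (cases "A = {}") (auto simp: P_def[symmetric] M_def[symmetric])
qed simp

lemma Fk_prime:
  assumes "prime p"
  shows "Fk k p = 0"
  using moebius_mu_prime_power[OF assms, of 1]
  by (simp add: Fk_def sigma_inverse_prime jordan_totient_prime assms)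

text \<open>With an even number of prime factors all four summands are nonnegative. With an odd number,
  \<open>F\<^sub>k(n) = \<Prod>(p\<^sup>k - 1) - \<Prod>(p\<^sup>k + 1) + 2\<close>, where the two products differ by exactly 2 for
  one prime and by more for several.\<close>

lemma Fk_squarefree_nonzero:
  assumes k: "k \<ge> 1" and n: "squarefree n" "n > 0" "\<not> prime n"
  shows "Fk k n \<noteq> 0"
proof -
  let ?A = "prime_factors n"
  define P where "P = (\<Prod>p\<in>?A. int p ^ k + 1)"
  define M where "M = (\<Prod>p\<in>?A. int p ^ k - 1)"
  have J: "jordan_totient k n = M"
    unfolding multiplicative_squarefree[OF multiplicative_jordan_totient n(1,2)] M_def
    by (intro prod.cong refl jordan_totient_prime) auto
  have "sigma_inverse k n = (\<Prod>p\<in>?A. (- 1) * (int p ^ k + 1))"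
    unfolding multiplicative_squarefree[OF multiplicative_sigma_inverse n(1,2)]
    by (intro prod.cong refl) (simp add: sigma_inverse_prime in_prime_factors_imp_prime)
  also have "\<dots> = (- 1) ^ card ?A * P"
    unfolding P_def by (simp only: prod.distrib prod_constant)
  finally have s: "sigma_inverse k n = (- 1) ^ card ?A * P" .
  have mu: "moebius_mu n = (- 1) ^ card ?A" using n by (simp add: moebius_mu_def)
  have ge2: "int p ^ k \<ge> 2" if "p \<in> ?A" for p
  proof -
    have "int p \<ge> 2" using that prime_ge_2_nat[of p] by auto
    moreover have "int p \<le> int p ^ k" using k calculation by (intro self_le_power) auto
    ultimately show ?thesis by linarith
  qed
  note gap = prod_shift_gap[of ?A "\<lambda>p. int p ^ k", OF _ ge2, folded P_def M_def]
  have "P \<ge> 0" unfolding P_def using ge2 by (intro prod_nonneg) auto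
  have "card ?A \<noteq> 1"
  proof
    assume "card ?A = 1"
    then obtain p where p: "?A = {p}" by (auto simp: card_1_singleton_iff)
    then have "multiplicity p n = 1" using squarefree_multiplicity_prime_factor[OF n(1)] by blast
    then have "n = p" using prod_prime_factors[of n] n p by simp
    then show False using p n by auto
  qed
  show ?thesis
  proof (cases "even (card ?A)")
    case True
    then show ?thesis using J s mu gap \<open>P \<ge> 0\<close> by (simp add: Fk_def)
  next
    case False
    then have "card ?A \<ge> 2" using \<open>card ?A \<noteq> 1\<close> by presburger
    then show ?thesis using J s mu gap False by (simp add: Fk_def)
  qed
qed

section \<open>Numbers with a square factor\<close>

text \<open>Local divisibility suffices: the value at the full power of \<open>p\<close> in \<open>n\<close> is a factor of \<open>f n\<close>.
  For \<open>c = 0\<close> this says that one vanishing local factor makes \<open>f n\<close> vanish.\<close>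

lemma multiplicative_dvd:
  assumes "multiplicative f" "n > 0" "p \<in> prime_factors n" "c dvd f (p ^ multiplicity p n)"
  shows "c dvd f n"
  unfolding multiplicative_eq_prod_prime_powers[OF assms(1,2)]
  using assms(3,4) by (meson dvd_prod_eqI dvd_prodI dvd_trans finite_set_mset)

text \<open>If \<open>p\<^sup>2\<close> divides \<open>n\<close>, then \<open>\<mu>(n) = 0\<close>, and both the inverse of \<open>\<sigma>\<^sub>k\<close> and \<open>J\<^sub>k\<close> are
  divisible by \<open>p\<^sup>k\<close> already in their local factor at \<open>p\<close>. So \<open>p\<^sup>k\<close> divides the constant 3.\<close>

lemma square_factor_of_zero:
  assumes k: "k \<ge> 1" and n: "n > 0" and p: "prime p" "p\<^sup>2 dvd n" and F: "Fk k n = 0"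
  shows "p = 3 \<and> k = 1"
proof -
  define e where "e = multiplicity p n"
  have e: "e \<ge> 2" unfolding e_def using n p by (intro multiplicity_geI) auto
  have pn: "p \<in> prime_factors n"
    using p n by (auto simp: in_prime_factors_iff intro: dvd_trans[of p "p\<^sup>2"])
  have "int p ^ k dvd sigma_inverse k n"
    using e by (intro multiplicative_dvd[OF multiplicative_sigma_inverse n pn])
      (simp add: sigma_inverse_prime_power[OF p(1)] flip: e_def)
  moreover have "int p ^ k dvd jordan_totient k n"
    using e by (intro multiplicative_dvd[OF multiplicative_jordan_totient n pn])
      (simp add: jordan_totient_prime_power[OF p(1)] dvd_power flip: e_def)
  moreover have "\<not> squarefree n"
    using p by (auto simp: squarefree_def dest: not_prime_unit)
  then have "3 = - (sigma_inverse k n + jordan_totient k n)"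
    using F by (simp add: Fk_def moebius_mu_def)
  ultimately have "int p ^ k dvd 3" by (metis dvd_add dvd_minus_iff)
  then have "int (p ^ k) dvd int 3" by simp
  then have dvd3: "p ^ k dvd 3" by (subst (asm) int_dvd_int_iff)
  have "p dvd p ^ k" using k by (simp add: dvd_power)
  with dvd3 have "p dvd 3" by (rule dvd_trans[rotated])
  then have "p = 3" using p(1) by (simp add: primes_dvd_imp_eq)
  moreover have "k = 1"
  proof (rule ccontr)
    assume "k \<noteq> 1"
    then have "(3::nat) ^ 2 \<le> 3 ^ k" using k by (intro power_increasing) auto
    then show False using dvd_imp_le[OF dvd3] \<open>p = 3\<close> by simp
  qed
  ultimately show ?thesis by simp
qed

lemma Fk_9_mult:
  assumes "m > 0" "coprime 9 m"
  shows "Fk 1 (9 * m) = 3 * (sigma_inverse 1 m + 2 * jordan_totient 1 m + 1)"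
proof -
  have p: "prime (3::nat)" by simp
  have "sigma_inverse 1 9 = 3"
    using sigma_inverse_prime_power[OF p, of 1 2] by simp
  moreover have "jordan_totient 1 9 = 6"
    using jordan_totient_prime_power[OF p, of 2 1] by simp
  moreover have "\<not> squarefree (9 * m)"
    using not_squarefreeI[of 3 "9 * m"] by (simp add: power2_eq_square)
  then have "moebius_mu (9 * m) = 0" by (simp add: moebius_mu_def)
  ultimately show ?thesis
    using multiplicativeD[OF multiplicative_sigma_inverse, of 9 m]
      multiplicativeD[OF multiplicative_jordan_totient, of 9 m] assms
    by (simp add: Fk_def)
qed

lemma Fk_18: "Fk 1 18 = 0"
proof -
  have "coprime (9::nat) 2" by (simp add: coprime_iff_gcd_eq_1 gcd_nat.simps)
  from Fk_9_mult[OF _ this] show ?thesis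
    by (simp add: sigma_inverse_prime jordan_totient_prime)
qed

text \<open>Only 3 can be a repeated prime factor, and it occurs exactly twice, for otherwise the inverse
  of \<open>\<sigma>\<^sub>k\<close> vanishes and \<open>F\<^sub>k(n) \<ge> 3\<close>. After division by 3, an odd prime factor \<open>p\<close> of
  \<open>n div 9\<close> would make the remaining sum odd, since its local factor \<open>-(1 + p)\<close> is even.\<close>

lemma zero_with_square_factor:
  assumes k: "k \<ge> 1" and n: "n > 0" "\<not> squarefree n" and F: "Fk k n = 0"
  shows "k = 1 \<and> n = 18"
proof -
  obtain p where p: "prime p" "p\<^sup>2 dvd n"
    using n by (auto simp: squarefree_factorial_semiring)
  have "p = 3" and k1: "k = 1" using square_factor_of_zero[OF k n(1) p F] by auto
  have p3: "prime (3::nat)" by simp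
  have dvd9: "9 dvd n" using p \<open>p = 3\<close> by simp
  define e where "e = multiplicity 3 n"
  have e: "e \<ge> 2" unfolding e_def using n dvd9 by (intro multiplicity_geI) auto
  have "e = 2"
  proof (rule ccontr)
    assume "e \<noteq> 2"
    then have "sigma_inverse k (3 ^ e) = 0"
      using e by (simp add: sigma_inverse_prime_power[OF p3])
    then have "0 dvd sigma_inverse k n"
      using dvd9 n by (intro multiplicative_dvd[OF multiplicative_sigma_inverse, of n 3])
        (auto simp: in_prime_factors_iff e_def intro: dvd_trans[of 3 9])
    then show False
      using F n jordan_totient_nonneg[of n k] by (simp add: Fk_def moebius_mu_def)
  qed
  define m where "m = n div 9"
  have nm: "n = 9 * m" using dvd9 by (simp add: m_def)
  have m: "m > 0" using n nm by auto
  have "\<not> 3 dvd m"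
  proof
    assume "3 dvd m"
    then have "3 ^ 3 dvd n" by (auto simp: nm)
    then have "3 \<le> e" unfolding e_def using n by (intro multiplicity_geI) auto
    with \<open>e = 2\<close> show False by simp
  qed
  then have "coprime (3 ^ 2) m" using p3 prime_imp_coprime coprime_power_left_iff by blast
  then have cop: "coprime 9 m" by simp
  have val: "sigma_inverse 1 m + 2 * jordan_totient 1 m + 1 = 0"
    using F Fk_9_mult[OF m cop] by (simp add: k1 nm)
  have sqf: "squarefree m"
  proof (rule ccontr)
    assume "\<not> squarefree m"
    then obtain q where q: "prime q" "q\<^sup>2 dvd m"
      using m by (auto simp: squarefree_factorial_semiring)
    then have "q = 3" using square_factor_of_zero[OF k n(1) q(1) _ F] by (simp add: nm)
    then show False using q \<open>\<not> 3 dvd m\<close> by (auto intro: dvd_trans[of 3 "3\<^sup>2"])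
  qed
  have only2: "q = 2" if q: "q \<in> prime_factors m" for q
  proof (rule ccontr)
    assume "q \<noteq> 2"
    have qp: "prime q" using q by auto
    then have "odd q" using \<open>q \<noteq> 2\<close> prime_odd_nat prime_ge_2_nat[of q] by fastforce
    moreover have "multiplicity q m = 1"
      using squarefree_multiplicity_prime_factor[OF sqf q] .
    ultimately have "2 dvd sigma_inverse 1 m"
      by (intro multiplicative_dvd[OF multiplicative_sigma_inverse m q])
        (simp add: sigma_inverse_prime[OF qp])
    moreover have "sigma_inverse 1 m = - (2 * jordan_totient 1 m) - 1" using val by simp
    ultimately show False by simp
  qed
  have "m dvd 2"
  proof (rule multiplicity_le_imp_dvd)
    fix q :: nat assume "prime q"
    show "multiplicity q m \<le> multiplicity q 2"
    proof (cases "q \<in> prime_factors m")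
      case True
      then show ?thesis
        using only2[OF True] squarefree_multiplicity_prime_factor[OF sqf True] by simp
    next
      case False
      then show ?thesis using \<open>prime q\<close> by (simp add: prime_factors_multiplicity)
    qed
  qed (use m in auto)
  then have "m \<le> 2" by (rule dvd_imp_le) simp
  moreover have "m \<noteq> 1"
    using val multiplicative_1[OF multiplicative_sigma_inverse]
      multiplicative_1[OF multiplicative_jordan_totient] by auto
  ultimately have "m = 2" using m by simp
  then show ?thesis using k1 nm by simp
qed

theorem theorem2:
  fixes k n :: nat
  assumes "k \<ge> 1" and "n \<ge> 1"
  shows "Fk k n = 0 \<longleftrightarrow> (if k = 1 then prime n \<or> n = 18 else prime n)"
proof
  assume F: "Fk k n = 0"
  show "if k = 1 then prime n \<or> n = 18 else prime n"
    using Fk_squarefree_nonzero[of k n] zero_with_square_factor[of k n] assms F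
    by (cases "squarefree n") auto
next
  assume "if k = 1 then prime n \<or> n = 18 else prime n"
  then show "Fk k n = 0"
    using Fk_prime[of n k] Fk_18 by (auto split: if_splits)
qed

end
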